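(* Let $\lambda : \mathbb{R} \rightarrow [1,+\infty)$ be a monotone increasing function which is in $\Omega(x^\varepsilon)$ with $\varepsilon \in (0,1)$, and let $\mathcal{P}$ be the set of all primes which are not greater than $\lambda(x)$. Then \[ Q_{\mathcal{P}}(x) \asymp x\,\frac{\ln\lambda(x)}{\ln x} \] as $x \rightarrow \infty$.
   Context: For a set of primes $\mathcal{P}$ and a positive real number $x$, $Q_{\mathcal{P}}(x)$ denotes the number of positive square-free integers $n \leq x$ which are only divisible by primes belonging to $\mathcal{P}$ (that is, every prime divisor of $n$ is in $\mathcal{P}$). Here $\mathcal{P}$ depends on $x$ through $\lambda(x)$. The notation $\lambda(x) \in \Omega(x^\varepsilon)$ means that there are constants $c>0$ and $x_0$ such that $\lambda(x) \geq c\,x^{\varepsilon}$ for all $x \geq x_0$. The notation $f(x) \asymp g(x)$ as $x \to \infty$ means that there are constants $c_1, c_2 > 0$ and $x_1$ such that $c_1 g(x) \leq f(x) \leq c_2 g(x)$ for all $x \geq x_1$.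
   Formalization: The formal statement adds that ln λ(x) = O(ln x), i.e. λ(x) is eventually at most a power of x. Without it the claim fails, e.g. for λ(x) = exp(max(0,x)), as Q_P(x) ≤ x; the condition is also necessary for the claimed estimate. *)

theory Defs
  imports
    Complex_Main
    "HOL-Library.Landau_Symbols"
    "HOL-Computational_Algebra.Squarefree"
begin

definition Q :: "nat set \<Rightarrow> real \<Rightarrow> nat" where
  "Q P x = card {n::nat. n > 0 \<and> real n \<le> x \<and> squarefree n \<and>
                         (\<forall>p. prime p \<longrightarrow> p dvd n \<longrightarrow> p \<in> P)}"

definition primes_upto :: "real \<Rightarrow> nat set" where
  "primes_upto y = {p::nat. prime p \<and> real p \<le> y}"

lemma Q_le:
  assumes "x \<ge> 0"
  shows "real (Q P x) \<le> x"
proof -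
  have "Q P x \<le> card {1..nat \<lfloor>x\<rfloor>}"
    unfolding Q_def by (rule card_mono) (auto simp: le_nat_floor)
  also have "\<dots> = nat \<lfloor>x\<rfloor>" by simp
  finally show ?thesis using assms by linarith
qed

(* Since Q P x \<le> x for every P, the asymptotic relation below can only hold when ln (lam x)
   is O(ln x).  It fails, for instance, for lam x = exp (max 0 x), although this function is
   monotone and dominates every power of x.  That growth condition is thus a necessary hypothesis
   of any theorem with this conclusion. *)
lemma Theta_imp_ln_growth:
  fixes lam :: "real \<Rightarrow> real"
  assumes "(\<lambda>x. real (Q (primes_upto (lam x)) x)) \<in> \<Theta>(\<lambda>x. x * (ln (lam x) / ln x))"
  shows "(\<lambda>x. ln (lam x)) \<in> O(\<lambda>x. ln x)"
proof -
  have "(\<lambda>x. x * (ln (lam x) / ln x)) \<in> O(\<lambda>x. real (Q (primes_upto (lam x)) x))"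
    using assms by (simp add: bigthetaD1 bigtheta_sym)
  also have "(\<lambda>x. real (Q (primes_upto (lam x)) x)) \<in> O(\<lambda>x. x)"
    by (rule bigoI[where c = 1])
       (use eventually_ge_at_top[of "0::real"] in eventually_elim, auto simp: Q_le)
  finally have "(\<lambda>x. (x * (ln (lam x) / ln x)) * (ln x / x)) \<in> O(\<lambda>x. x * (ln x / x))"
    by (rule landau_o.big.mult) simp
  moreover have "eventually (\<lambda>x. (x * (ln (lam x) / ln x)) * (ln x / x) = ln (lam x)) at_top"
    using eventually_gt_at_top[of "1::real"] by eventually_elim simp
  moreover have "eventually (\<lambda>x::real. x * (ln x / x) = ln x) at_top"
    using eventually_gt_at_top[of "1::real"] by eventually_elim simp
  ultimately show ?thesis
    by (simp add: landau_o.big.in_cong landau_o.big.cong)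
qed

end

theory Submission
  imports Defs
begin

text \<open>
  The two growth hypotheses on \<open>lam\<close> confine \<open>ln (lam x) / ln x\<close> between two positive constants,
  so the claim is that a positive proportion of the integers up to \<open>x\<close> is square-free with all prime
  factors at most \<open>lam x\<close>. The upper bound is the trivial \<open>Q P x \<le> x\<close>. For the lower bound choose an
  integer \<open>K > 1 / \<epsilon>\<close>; then \<open>x powr (1 / K) \<le> lam x\<close> for large \<open>x\<close>, and it suffices to treat the bound
  \<open>x powr (1 / K)\<close> on the prime factors (\<open>eventually_Q_root_ge\<close>).

  The required integers are written as \<open>m * g\<close>, where \<open>g\<close> is a product of exactly \<open>K\<close> distinct primes
  from the interval \<open>(x powr (1 / (K + 1)), x powr (1 / K)]\<close>. Then \<open>x powr (K / (K + 1)) \<le> g \<le> x\<close>, and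
  so every \<open>m \<le> x / g\<close> is at most \<open>x powr (1 / (K + 1))\<close>. All its prime factors therefore lie below
  those of \<open>g\<close>, so the bound on the prime factors of \<open>m\<close> comes for free, \<open>m\<close> and \<open>g\<close> are coprime,
  and \<open>m * g\<close> determines both of them. As at least \<open>t / 8\<close> integers up to \<open>t\<close> are square-free
  (\<open>card_squarefree_ge\<close>), this gives at least \<open>x / 8\<close> times the sum of \<open>1 / g\<close> many integers.

  It remains to bound the sum of \<open>1 / g\<close> from below by a positive constant
  (\<open>eventually_prime_products\<close>). Splitting the interval into \<open>K\<close> parts and taking one prime from each,
  this follows from the same statement for the sum of \<open>1 / p\<close> over the primes
  between two powers of \<open>x\<close> (\<open>eventually_sum_inverse_primes_ge\<close>), which is a consequence of Mertens'
  first theorem: the sum of \<open>ln p / p\<close> over the primes up to \<open>n\<close> is \<open>ln n + O(1)\<close>. The latter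
  is obtained from the prime factorization of \<open>n!\<close> and Chebyshev's bound on the product of the
  primes up to \<open>n\<close>.
\<close>

section \<open>Chebyshev's upper bound\<close>

lemma finite_primes_le: "finite {p::nat. prime p \<and> p \<le> n}"
  by (rule finite_subset[of _ "{..n}"]) auto

lemma prod_primes_dvd:
  fixes m :: nat
  assumes "finite A" "\<And>p. p \<in> A \<Longrightarrow> prime p \<and> p dvd m"
  shows "\<Prod>A dvd m"
  using assms
proof (induction A rule: finite_induct)
  case (insert p A)
  have "coprime p (\<Prod>A)"
    by (rule prod_coprime_right) (use insert in \<open>auto intro!: primes_coprime\<close>)
  with insert show ?case by (auto intro!: divides_mult)
qed auto

text \<open>
  The coefficient occurs twice in its row, whose sum is \<open>2 * 4 ^ m\<close>.
\<close>

lemma binomial_odd_middle_le: "(2 * m + 1) choose m \<le> 4 ^ m"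
proof -
  have "((2*m+1) choose m) + ((2*m+1) choose (m+1)) = (\<Sum>k\<in>{m,m+1}. (2*m+1) choose k)"
    by (subst sum.insert) auto
  also have "\<dots> \<le> (\<Sum>k\<le>2*m+1. (2*m+1) choose k)"
    by (rule sum_mono2) auto
  also have "\<dots> = 2 ^ (2*m+1)" by (rule choose_row_sum)
  also have "(2*m+1) choose (m+1) = (2*m+1) choose m"
    by (subst binomial_symmetric) auto
  finally show ?thesis by (simp add: power_mult)
qed

text \<open>
  The argument of Erdos. For odd \<open>n = 2 * m + 1\<close>, the primes in \<open>(m + 1, 2 * m + 1]\<close> divide the
  numerator but not the denominator of the middle binomial coefficient, so their product is at most
  \<open>4 ^ m\<close>, and induction handles the primes up to \<open>m + 1\<close>. An even \<open>n > 2\<close> contributes no new prime.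
\<close>

lemma prod_primes_le: "\<Prod>{p::nat. prime p \<and> p \<le> n} \<le> 4 ^ n"
proof (induction n rule: less_induct)
  case (less n)
  consider "n \<le> 1" | "n = 2" | m where "n = 2 * m" "m \<ge> 2" | m where "n = 2 * m + 1" "m \<ge> 1"
    by (cases "even n") (auto elim!: evenE oddE, force+)
  then show ?case
  proof cases
    case 1
    then have *: "{p::nat. prime p \<and> p \<le> n} = {}" by (auto dest: prime_ge_2_nat)
    show ?thesis unfolding * by simp
  next
    case 2
    then have *: "{p::nat. prime p \<and> p \<le> n} = {2}"
      by (auto dest: prime_ge_2_nat intro: antisym)
    show ?thesis unfolding * using 2 by simp
  next
    case (3 m)
    have "\<not> prime n" using 3 prime_product[of 2 m] by auto
    then have "p \<le> n \<longleftrightarrow> p \<le> n - 1" if "prime p" for p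
      using that by (cases "p = n") auto
    then have *: "{p::nat. prime p \<and> p \<le> n} = {p. prime p \<and> p \<le> n - 1}" by auto
    have "\<Prod>{p. prime p \<and> p \<le> n - 1} \<le> 4 ^ (n - 1)" using 3 by (intro less) auto
    also have "\<dots> \<le> 4 ^ n" by (rule power_increasing) auto
    finally show ?thesis unfolding * .
  next
    case (4 m)
    define B where "B = {p::nat. prime p \<and> m + 1 < p \<and> p \<le> 2 * m + 1}"
    have finB: "finite B" unfolding B_def by (rule finite_subset[of _ "{..2*m+1}"]) auto
    have "{p::nat. prime p \<and> p \<le> n} = {p. prime p \<and> p \<le> m + 1} \<union> B"
      unfolding B_def 4 by auto
    then have "\<Prod>{p::nat. prime p \<and> p \<le> n} = \<Prod>{p. prime p \<and> p \<le> m + 1} * \<Prod>B"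
      using finB finite_primes_le by (simp add: prod.union_disjoint B_def disjoint_iff)
    moreover have "\<Prod>{p::nat. prime p \<and> p \<le> m + 1} \<le> 4 ^ (m + 1)" using 4 by (intro less) auto
    moreover have "\<Prod>B dvd (2 * m + 1) choose m"
    proof (rule prod_primes_dvd[OF finB])
      fix p assume p: "p \<in> B"
      have "fact m * fact (m + 1) * ((2 * m + 1) choose m) = (fact (2 * m + 1) :: nat)"
        using binomial_fact_lemma[of m "2*m+1"] by simp
      moreover have "p dvd (fact (2 * m + 1) :: nat)" "\<not> p dvd (fact m :: nat)" "\<not> p dvd (fact (m + 1) :: nat)"
        using p unfolding B_def by (simp_all only: prime_dvd_fact_iff mem_Collect_eq) auto
      ultimately show "prime p \<and> p dvd ((2 * m + 1) choose m)"
        using p unfolding B_def by (metis (no_types, lifting) mem_Collect_eq prime_dvd_mult_iff)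
    qed
    then have "\<Prod>B \<le> (2 * m + 1) choose m" by (rule dvd_imp_le) simp
    then have "\<Prod>B \<le> 4 ^ m" using binomial_odd_middle_le[of m] by linarith
    ultimately have "\<Prod>{p::nat. prime p \<and> p \<le> n} \<le> 4 ^ (m + 1) * 4 ^ m"
      by (simp add: mult_le_mono)
    then show ?thesis unfolding 4 by (simp add: power_add mult_2)
  qed
qed

lemma sum_ln_primes_le: "(\<Sum>p | prime p \<and> p \<le> n. ln (real p)) \<le> real n * ln 4"
proof -
  have "(\<Sum>p | prime p \<and> p \<le> n. ln (real p)) = ln (real (\<Prod>{p::nat. prime p \<and> p \<le> n}))"
    unfolding of_nat_prod by (subst ln_prod) (auto simp: finite_primes_le prime_gt_0_nat)
  also have "\<dots> \<le> ln (real (4 ^ n))"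
    using prod_primes_le[of n]
    by (intro ln_mono) (auto simp: prime_gt_0_nat simp del: of_nat_prod of_nat_power intro!: prod_pos)
  finally show ?thesis by (simp add: ln_realpow)
qed

section \<open>The prime factorization of factorials\<close>

text \<open>
  One step of Legendre's formula. Unrolled once it gives the lower bound \<open>n div p\<close> on the
  multiplicity, iterated it gives the upper bound below. In the induction, a factor \<open>Suc n\<close> changes
  either side only if it is a multiple of \<open>p\<close>, and then it is \<open>p\<close> times the factor that is new in
  the factorial on the right.
\<close>

lemma multiplicity_fact_rec:
  fixes p n :: nat
  assumes p: "prime p"
  shows "multiplicity p (fact n) = n div p + multiplicity p (fact (n div p))"
proof (induction n)
  case 0 then show ?case by simp
next
  case (Suc n)
  have p0: "p > 0" using p by (simp add: prime_gt_0_nat)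
  have pe: "prime_elem p" using p by simp
  have mult_Suc: "multiplicity p (fact (Suc k)) = multiplicity p (Suc k) + multiplicity p (fact k)" for k
    unfolding fact_Suc of_nat_id
    by (rule prime_elem_multiplicity_mult_distrib[OF pe]) simp_all
  show ?case
  proof (cases "p dvd Suc n")
    case True
    then have "Suc n div p = Suc (n div p)" using p0 by (simp add: div_Suc mod_eq_0_iff_dvd)
    moreover from True this have "Suc n = p * Suc (n div p)"
      by (metis dvd_mult_div_cancel)
    then have "multiplicity p (Suc n) = Suc (multiplicity p (Suc (n div p)))"
      using multiplicity_times_same[where p = p and x = "Suc (n div p)"] p0 prime_ge_2_nat[OF p] by (auto simp del: mult_Suc_right)
    ultimately show ?thesis using Suc mult_Suc[of n] mult_Suc[of "n div p"] by simp
  next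
    case False
    then have "Suc n div p = n div p" using p0 by (simp add: div_Suc mod_eq_0_iff_dvd)
    moreover have "multiplicity p (Suc n) = 0" using False by (rule not_dvd_imp_multiplicity_0)
    ultimately show ?thesis using Suc mult_Suc[of n] by simp
  qed
qed

lemma multiplicity_fact_le:
  fixes p n :: nat
  assumes p: "prime p"
  shows "multiplicity p (fact n) * (p - 1) \<le> n"
proof (induction n rule: less_induct)
  case (less n)
  have p2: "p \<ge> 2" using p by (rule prime_ge_2_nat)
  show ?case
  proof (cases "n = 0")
    case False
    let ?q = "n div p"
    have "multiplicity p (fact n) * (p - 1) = ?q * (p - 1) + multiplicity p (fact ?q) * (p - 1)"
      using multiplicity_fact_rec[OF p, of n] by (simp add: add_mult_distrib)
    also have "\<dots> \<le> ?q * (p - 1) + ?q"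
      using less[of ?q] False p2 by simp
    also have "\<dots> = ?q * p" using p2 by (cases p) auto
    also have "\<dots> \<le> n" by simp
    finally show ?thesis .
  qed simp
qed

lemma ln_fact_eq_sum_primes:
  "ln (fact n :: real) = (\<Sum>p | prime p \<and> p \<le> n. real (multiplicity p (fact n :: nat)) * ln (real p))"
proof -
  have pf: "prime_factors (fact n :: nat) = {p. prime p \<and> p \<le> n}"
    unfolding prime_factors_fact by (auto dest: prime_ge_2_nat)
  have "(fact n :: nat) = (\<Prod>p | prime p \<and> p \<le> n. p ^ multiplicity p (fact n :: nat))"
    using prod_prime_factors[of "fact n :: nat"] unfolding pf by simp
  then have "(fact n :: real) = (\<Prod>p | prime p \<and> p \<le> n. real p ^ multiplicity p (fact n :: nat))"
    by (metis (mono_tags, lifting) of_nat_fact of_nat_power of_nat_prod prod.cong)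
  then show ?thesis
    by (simp, subst ln_prod) (auto simp: finite_primes_le ln_realpow prime_gt_0_nat)
qed

text \<open>
  Stirling's lower bound; the induction step is \<open>ln (1 + 1 / n) \<le> 1 / n\<close>.
\<close>

lemma ln_fact_ge:
  fixes n :: nat
  assumes "n > 0"
  shows "real n * ln n - n \<le> ln (fact n)"
  using assms
proof (induction n rule: nat_induct_non_zero)
  case (Suc n)
  have "ln (1 + 1 / real n) \<le> 1 / real n" by (rule ln_add_one_self_le_self) simp
  moreover have "1 + 1 / real n = (1 + real n) / real n" using Suc by (simp add: field_simps)
  ultimately have "ln (1 + real n) - ln (real n) \<le> 1 / n" using Suc by (simp add: ln_div)
  then have "real n * (ln (1 + real n) - ln (real n)) \<le> 1" using Suc by (simp add: field_simps)
  moreover have "ln (fact (Suc n)) = ln (1 + real n) + ln (fact n)"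
    unfolding fact_Suc by (subst ln_mult) auto
  ultimately show ?case using Suc by (simp add: algebra_simps)
qed simp

lemma ln_fact_le: "ln (fact n) \<le> real n * ln n"
proof (cases "n = 0")
  case False
  have "ln (fact n :: real) \<le> ln (real n ^ n)"
    using fact_le_power[of n, where 'a = real] False by (intro ln_mono) auto
  then show ?thesis using False by (simp add: ln_realpow)
qed simp

section \<open>Mertens' first theorem\<close>

text \<open>
  The right-hand side telescopes: with \<open>f n = (ln n + 2) / n\<close>, each summand is at most
  \<open>f (k - 1) - f k\<close>. The constant \<open>2\<close> inside \<open>f\<close> is what makes \<open>ln (1 + 1 / n) \<le> 1 / n\<close> sufficient.
\<close>

lemma sum_ln_over_square_le:
  fixes n :: nat
  assumes "n \<ge> 1"
  shows "(\<Sum>k=2..n. ln (real k) / (real k * (real k - 1))) \<le> 2 - (ln n + 2) / n"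
  using assms
proof (induction n rule: nat_induct_at_least)
  case (Suc n)
  have n: "real n > 0" using Suc by simp
  have "ln (1 + 1 / real n) \<le> 1 / real n" by (rule ln_add_one_self_le_self) simp
  moreover have "1 + 1 / real n = (1 + real n) / real n" using n by (simp add: field_simps)
  ultimately have 1: "ln (1 + real n) - ln (real n) \<le> 1 / n" using n by (simp add: ln_div)
  have "1 / real n \<le> 2 / (1 + real n)" using Suc by (simp add: field_simps)
  moreover have "2 * n / (1 + n) = 2 - 2 / (1 + real n)" using n by (simp add: field_simps)
  ultimately have "ln (1 + real n) + 2 * n / (1 + n) \<le> ln n + 2" using 1 by linarith
  then have "(ln (1 + real n) + 2 * n / (1 + n)) / n \<le> (ln n + 2) / n"
    using n by (intro divide_right_mono) auto
  moreover have "ln (1 + real n) / ((1 + real n) * n) + (ln (1 + real n) + 2) / (1 + n) =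
      (ln (1 + real n) + 2 * n / (1 + n)) / n"
    using n by (simp add: divide_simps) (simp add: algebra_simps)
  ultimately have "ln (1 + real n) / ((1 + real n) * n) + (ln (1 + real n) + 2) / (1 + n) \<le> (ln n + 2) / n"
    by simp
  then show ?case using Suc by simp
qed simp

text \<open>
  Each prime \<open>p \<le> n\<close> divides \<open>n!\<close> at least \<open>n / p - 1\<close> times, and \<open>ln n! \<le> n * ln n\<close>. The error
  from the terms \<open>- 1\<close> is the sum of \<open>ln p\<close>, which Chebyshev's bound keeps linear in \<open>n\<close>.
\<close>

lemma Mertens_upper:
  fixes n :: nat
  assumes "n > 0"
  shows "(\<Sum>p | prime p \<and> p \<le> n. ln (real p) / p) \<le> ln n + ln 4"
proof -
  have "real n * (\<Sum>p | prime p \<and> p \<le> n. ln (real p) / p) - (\<Sum>p | prime p \<and> p \<le> n. ln (real p)) =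
      (\<Sum>p | prime p \<and> p \<le> n. (n / p - 1) * ln (real p))"
    by (simp add: sum_distrib_left sum_subtractf algebra_simps)
  also have "\<dots> \<le> (\<Sum>p | prime p \<and> p \<le> n. real (multiplicity p (fact n :: nat)) * ln (real p))"
  proof (rule sum_mono)
    fix p assume "p \<in> {p. prime p \<and> p \<le> n}"
    then have p: "prime p" by simp
    have "real n / p - 1 \<le> real (n div p)"
    proof -
      have "n < p + (n div p) * p" using prime_gt_0_nat[OF p] by (rule dividend_less_div_times)
      then have "real n < real (p + (n div p) * p)" by (simp only: of_nat_less_iff)
      then show ?thesis using prime_gt_0_nat[OF p] by (simp add: field_simps)
    qed
    also have "\<dots> \<le> real (multiplicity p (fact n :: nat))"
      using multiplicity_fact_rec[OF p, of n] by simp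
    finally show "(n / p - 1) * ln (real p) \<le> real (multiplicity p (fact n :: nat)) * ln (real p)"
      using prime_gt_0_nat[OF p] by (intro mult_right_mono) auto
  qed
  also have "\<dots> \<le> n * ln n"
    using ln_fact_le[of n] by (simp add: ln_fact_eq_sum_primes)
  finally have "real n * (\<Sum>p | prime p \<and> p \<le> n. ln (real p) / p) \<le> n * (ln n + ln 4)"
    using sum_ln_primes_le[of n] by (simp add: algebra_simps)
  then show ?thesis using assms by simp
qed

text \<open>
  Each prime \<open>p\<close> divides \<open>n!\<close> at most \<open>n / (p - 1)\<close> times, and \<open>1 / (p - 1)\<close> differs from \<open>1 / p\<close> by
  \<open>1 / (p * (p - 1))\<close>, whose contribution is bounded by a convergent series.
\<close>

lemma Mertens_lower:
  fixes n :: nat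
  assumes "n > 0"
  shows "(\<Sum>p | prime p \<and> p \<le> n. ln (real p) / p) \<ge> ln n - 3"
proof -
  have "n * ln n - n \<le> (\<Sum>p | prime p \<and> p \<le> n. real (multiplicity p (fact n :: nat)) * ln (real p))"
    using ln_fact_ge[OF assms] by (simp add: ln_fact_eq_sum_primes)
  also have "\<dots> \<le> (\<Sum>p | prime p \<and> p \<le> n. n * (ln (real p) / p + ln (real p) / (real p * (real p - 1))))"
  proof (rule sum_mono)
    fix p assume "p \<in> {p. prime p \<and> p \<le> n}"
    then have p: "prime p" by simp
    have p2: "p \<ge> 2" using p by (rule prime_ge_2_nat)
    have "real (multiplicity p (fact n :: nat) * (p - 1)) \<le> real n"
      using multiplicity_fact_le[OF p, of n] by (simp only: of_nat_le_iff)
    then have "real (multiplicity p (fact n :: nat)) \<le> n / (real p - 1)"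
      using p2 by (simp add: field_simps of_nat_diff)
    then have "real (multiplicity p (fact n :: nat)) * ln (real p) \<le> n / (real p - 1) * ln (real p)"
      using p2 by (intro mult_right_mono) auto
    also have "\<dots> = n * (ln (real p) / p + ln (real p) / (real p * (real p - 1)))"
      using p2 by (simp add: divide_simps) (simp add: algebra_simps)
    finally show "real (multiplicity p (fact n :: nat)) * ln (real p) \<le> \<dots>" .
  qed
  also have "\<dots> = n * ((\<Sum>p | prime p \<and> p \<le> n. ln (real p) / p) +
      (\<Sum>p | prime p \<and> p \<le> n. ln (real p) / (real p * (real p - 1))))"
    by (simp add: sum_distrib_left sum.distrib distrib_left)
  finally have "n * (ln n - 1) \<le> n * ((\<Sum>p | prime p \<and> p \<le> n. ln (real p) / p) +
      (\<Sum>p | prime p \<and> p \<le> n. ln (real p) / (real p * (real p - 1))))"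
    by (simp add: algebra_simps)
  then have "ln n - 1 \<le> (\<Sum>p | prime p \<and> p \<le> n. ln (real p) / p) +
      (\<Sum>p | prime p \<and> p \<le> n. ln (real p) / (real p * (real p - 1)))"
    using assms by simp
  moreover have "(\<Sum>p | prime p \<and> p \<le> n. ln (real p) / (real p * (real p - 1))) \<le>
      (\<Sum>k=2..n. ln (real k) / (real k * (real k - 1)))"
    by (rule sum_mono2) (auto dest: prime_ge_2_nat)
  moreover have "\<dots> \<le> 2"
  proof -
    have "0 \<le> (ln (real n) + 2) / real n"
      using assms by (intro divide_nonneg_nonneg add_nonneg_nonneg ln_ge_zero) auto
    then show ?thesis using sum_ln_over_square_le[of n] assms by linarith
  qed
  ultimately show ?thesis by linarith
qed

text \<open>
  The difference of the two Mertens bounds at \<open>\<lfloor>w\<rfloor>\<close> and \<open>\<lfloor>z\<rfloor>\<close>. The constant \<open>7\<close> covers the error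
  terms \<open>3\<close> and \<open>ln 4 \<le> 3\<close>, and \<open>ln 2 \<le> 1\<close> from \<open>\<lfloor>w\<rfloor> \<ge> w / 2\<close>.
\<close>

lemma sum_ln_over_prime_interval:
  fixes z w :: real
  assumes "1 \<le> z" "z \<le> w"
  shows "(\<Sum>p | prime p \<and> z < real p \<and> real p \<le> w. ln (real p) / p) \<ge> ln w - ln z - 7"
proof -
  define L N where "L = nat \<lfloor>z\<rfloor>" and "N = nat \<lfloor>w\<rfloor>"
  have L: "L > 0" "real L \<le> z" using assms unfolding L_def by linarith+
  have "L \<le> N" unfolding L_def N_def using assms by (intro nat_mono floor_mono)
  moreover have "w - 1 < real N" using assms unfolding N_def by linarith
  ultimately have N: "N > 0" "real N \<ge> w / 2" using L(1) by linarith+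
  have le_L: "real p \<le> z \<longleftrightarrow> p \<le> L" for p
    using assms unfolding L_def by (simp add: le_nat_iff le_floor_iff)
  have le_N: "real p \<le> w \<longleftrightarrow> p \<le> N" for p
    using assms unfolding N_def by (simp add: le_nat_iff le_floor_iff)
  have *: "{p. prime p \<and> z < real p \<and> real p \<le> w} = {p. prime p \<and> p \<le> N} - {p. prime p \<and> p \<le> L}"
    by (auto simp: le_L[symmetric] le_N[symmetric])
  have "(\<Sum>p | prime p \<and> z < real p \<and> real p \<le> w. ln (real p) / p) =
     (\<Sum>p | prime p \<and> p \<le> N. ln (real p) / p) - (\<Sum>p | prime p \<and> p \<le> L. ln (real p) / p)"
    unfolding * by (rule sum_diff[OF finite_primes_le]) (use \<open>L \<le> N\<close> in auto)
  moreover have "ln (real L) \<le> ln z" using L by simp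
  moreover have "ln (w / 2) \<le> ln (real N)" using N assms by simp
  moreover have "ln (w / 2) = ln w - ln 2" using assms by (simp add: ln_div)
  moreover have "ln (2::real) \<le> 1" "ln (4::real) \<le> 3"
    using ln_le_minus_one[of "2::real"] ln_le_minus_one[of "4::real"] by simp_all
  ultimately show ?thesis using Mertens_upper[OF L(1)] Mertens_lower[OF N(1)] by linarith
qed

text \<open>
  Every prime \<open>p\<close> in the range has \<open>ln p \<le> \<beta> * ln x\<close>, so the sum of \<open>1 / p\<close> is at least
  \<open>((\<beta> - \<alpha>) * ln x - 7) / (\<beta> * ln x)\<close>, which tends to \<open>1 - \<alpha> / \<beta>\<close>. (The true limit is
  \<open>ln (\<beta> / \<alpha>)\<close>, but any positive constant will do.)
\<close>

lemma eventually_sum_inverse_primes_ge: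
  fixes \<alpha> \<beta> :: real
  assumes "0 < \<alpha>" "\<alpha> < \<beta>"
  shows "\<forall>\<^sub>F x in at_top. (1 - \<alpha> / \<beta>) / 2 \<le> (\<Sum>p | prime p \<and> x powr \<alpha> < real p \<and> real p \<le> x powr \<beta>. 1 / real p)"
  \<comment> \<open>From this point on, the error \<open>7\<close> is at most half of \<open>(\<beta> - \<alpha>) * ln x\<close>.\<close>
  using eventually_gt_at_top[of "1::real"] eventually_ge_at_top[of "exp (14 / (\<beta> - \<alpha>))"]
proof eventually_elim
  case (elim x)
  let ?A = "{p. prime p \<and> x powr \<alpha> < real p \<and> real p \<le> x powr \<beta>}"
  have L: "ln x \<ge> 14 / (\<beta> - \<alpha>)" "ln x > 0" using elim by (auto simp: ln_ge_iff)
  have "\<beta> * ln x - \<alpha> * ln x - 7 \<le> (\<Sum>p\<in>?A. ln (real p) / p)"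
    using sum_ln_over_prime_interval[of "x powr \<alpha>" "x powr \<beta>"] elim assms
    by (simp add: ln_powr ge_one_powr_ge_zero)
  also have "\<dots> \<le> (\<Sum>p\<in>?A. \<beta> * ln x * (1 / real p))"
  proof (rule sum_mono)
    fix p assume p: "p \<in> ?A"
    then have "ln (real p) \<le> ln (x powr \<beta>)" using elim prime_gt_0_nat[of p] by (subst ln_le_cancel_iff) auto
    then show "ln (real p) / p \<le> \<beta> * ln x * (1 / real p)"
      using elim by (simp add: ln_powr divide_right_mono)
  qed
  also have "\<dots> = \<beta> * ln x * (\<Sum>p\<in>?A. 1 / real p)" by (simp add: sum_distrib_left)
  finally have "(\<beta> * ln x - \<alpha> * ln x - 7) / (\<beta> * ln x) \<le> (\<Sum>p\<in>?A. 1 / real p)"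
    using L assms by (simp add: divide_simps mult.commute)
  moreover have "(1 - \<alpha> / \<beta>) / 2 \<le> (\<beta> * ln x - \<alpha> * ln x - 7) / (\<beta> * ln x)"
  proof -
    have "14 \<le> (\<beta> - \<alpha>) * ln x" using L assms by (simp add: field_simps)
    then have "(\<beta> - \<alpha>) * ln x / 2 \<le> \<beta> * ln x - \<alpha> * ln x - 7"
      by (subst left_diff_distrib[symmetric]) linarith
    then have "(\<beta> - \<alpha>) * ln x / 2 / (\<beta> * ln x) \<le> (\<beta> * ln x - \<alpha> * ln x - 7) / (\<beta> * ln x)"
      using L assms by (intro divide_right_mono) auto
    moreover have "(\<beta> - \<alpha>) * ln x / 2 / (\<beta> * ln x) = (1 - \<alpha> / \<beta>) / 2"
      using L assms by (simp add: field_simps)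
    ultimately show ?thesis by (simp only:)
  qed
  ultimately show ?case by linarith
qed

section \<open>Integers with only small or only large prime factors\<close>

definition smooth :: "real \<Rightarrow> nat \<Rightarrow> bool" where
  "smooth z n \<longleftrightarrow> (\<forall>p. prime p \<longrightarrow> p dvd n \<longrightarrow> real p \<le> z)"

definition rough :: "real \<Rightarrow> nat \<Rightarrow> bool" where
  "rough z n \<longleftrightarrow> (\<forall>p. prime p \<longrightarrow> p dvd n \<longrightarrow> z < real p)"

lemma smooth_mono: "smooth y n \<Longrightarrow> y \<le> z \<Longrightarrow> smooth z n"
  unfolding smooth_def by (blast intro: order.trans)

lemma rough_antimono: "rough z n \<Longrightarrow> y \<le> z \<Longrightarrow> rough y n"
  unfolding rough_def by (blast intro: le_less_trans)

lemma smooth_mult: "smooth z m \<Longrightarrow> smooth z n \<Longrightarrow> smooth z (m * n)"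
  unfolding smooth_def by (auto simp: prime_dvd_mult_iff)

lemma rough_mult: "rough z m \<Longrightarrow> rough z n \<Longrightarrow> rough z (m * n)"
  unfolding rough_def by (auto simp: prime_dvd_mult_iff)

lemma smooth_prime: "prime p \<Longrightarrow> real p \<le> z \<Longrightarrow> smooth z p"
  unfolding smooth_def by (auto dest: primes_dvd_imp_eq)

lemma rough_prime: "prime p \<Longrightarrow> z < real p \<Longrightarrow> rough z p"
  unfolding rough_def by (auto dest: primes_dvd_imp_eq)

lemma smooth_le: "n > 0 \<Longrightarrow> real n \<le> z \<Longrightarrow> smooth z n"
  unfolding smooth_def by (auto dest!: dvd_imp_le intro: order.trans[OF of_nat_mono])

lemma coprime_smooth_rough:
  assumes "smooth z a" "rough z b"
  shows "coprime a b"
proof (rule ccontr)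
  assume "\<not> coprime a b"
  then have "gcd a b \<noteq> 1" by (simp add: coprime_iff_gcd_eq_1)
  then obtain p where p: "prime p" "p dvd gcd a b" using prime_factor_nat by blast
  then have "real p \<le> z" "z < real p" using assms unfolding smooth_def rough_def by simp_all
  then show False by linarith
qed

text \<open>
  Crosswise coprimality forces \<open>a\<close> and \<open>a'\<close> to divide each other. This makes multiplication
  injective on pairs of a smooth and a rough number, so that the products below can be counted
  without multiplicity.
\<close>

lemma smooth_rough_factorization_unique:
  assumes "smooth z a" "rough z b" "smooth z a'" "rough z b'" "a > 0" "a * b = a' * b'"
  shows "a = a'" "b = b'"
proof -
  have "a dvd a'" using coprime_smooth_rough[OF assms(1,4)] assms(6)
    by (metis coprime_dvd_mult_left_iff dvd_triv_left)
  moreover have "a' dvd a" using coprime_smooth_rough[OF assms(3,2)] assms(6)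
    by (metis coprime_dvd_mult_left_iff dvd_triv_left)
  ultimately show "a = a'" by (rule dvd_antisym)
  with assms show "b = b'" by simp
qed

text \<open>
  Induction on the number \<open>j\<close> of primes, for all \<open>\<beta>\<close> at once: at the midpoint \<open>\<gamma>\<close> of \<open>\<alpha>\<close> and \<open>\<beta>\<close>, take
  products of \<open>j\<close> primes from \<open>(x powr \<alpha>, x powr \<gamma>]\<close> and multiply them by one more prime from
  \<open>(x powr \<gamma>, x powr \<beta>]\<close>. The separation of the two ranges makes the new products distinct and
  square-free, and so the sums of reciprocals multiply.
\<close>

lemma eventually_prime_products:
  fixes \<alpha> \<beta> :: real and j :: nat
  assumes "0 < \<alpha>" "\<alpha> < \<beta>"
  shows "\<exists>c>0. \<forall>\<^sub>F x in at_top. \<exists>G. finite G \<and>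
           (\<forall>g\<in>G. squarefree g \<and> rough (x powr \<alpha>) g \<and> smooth (x powr \<beta>) g \<and>
                  x powr (j * \<alpha>) \<le> real g \<and> real g \<le> x powr (j * \<beta>)) \<and>
           c \<le> (\<Sum>g\<in>G. 1 / real g)"
  using assms(2)
proof (induction j arbitrary: \<beta>)
  case 0
  show ?case
  proof (intro exI[of _ 1] conjI)
    show "\<forall>\<^sub>F x in at_top. \<exists>G. finite G \<and>
           (\<forall>g\<in>G. squarefree g \<and> rough (x powr \<alpha>) g \<and> smooth (x powr \<beta>) g \<and>
                  x powr (real 0 * \<alpha>) \<le> real g \<and> real g \<le> x powr (real 0 * \<beta>)) \<and>
           1 \<le> (\<Sum>g\<in>G. 1 / real g)"
      using eventually_gt_at_top[of "1::real"]
      by eventually_elim (rule exI[of _ "{1}"], auto simp: rough_def smooth_def)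
  qed simp
next
  case (Suc j)
  define \<gamma> where "\<gamma> = (\<alpha> + \<beta>) / 2"
  have \<gamma>: "\<alpha> < \<gamma>" "\<gamma> < \<beta>" using Suc.prems unfolding \<gamma>_def by simp_all
  from Suc.IH[OF \<gamma>(1)] obtain c where c: "c > 0"
    and ev: "\<forall>\<^sub>F x in at_top. \<exists>G. finite G \<and>
           (\<forall>g\<in>G. squarefree g \<and> rough (x powr \<alpha>) g \<and> smooth (x powr \<gamma>) g \<and>
                  x powr (j * \<alpha>) \<le> real g \<and> real g \<le> x powr (j * \<gamma>)) \<and>
           c \<le> (\<Sum>g\<in>G. 1 / real g)" by blast
  have c': "c * ((1 - \<gamma> / \<beta>) / 2) > 0" using c \<gamma> assms(1) by simp
  have "0 < \<gamma>" using \<gamma> assms(1) by linarith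
  have "\<forall>\<^sub>F x in at_top. \<exists>G. finite G \<and>
           (\<forall>g\<in>G. squarefree g \<and> rough (x powr \<alpha>) g \<and> smooth (x powr \<beta>) g \<and>
                  x powr (Suc j * \<alpha>) \<le> real g \<and> real g \<le> x powr (Suc j * \<beta>)) \<and>
           c * ((1 - \<gamma> / \<beta>) / 2) \<le> (\<Sum>g\<in>G. 1 / real g)"
    using ev eventually_sum_inverse_primes_ge[OF \<open>0 < \<gamma>\<close> \<gamma>(2)] eventually_gt_at_top[of "1::real"]
  proof eventually_elim
    case (elim x)
    then obtain G where G: "finite G" "c \<le> (\<Sum>g\<in>G. 1 / real g)"
      and Gg: "\<And>g. g \<in> G \<Longrightarrow> squarefree g" "\<And>g. g \<in> G \<Longrightarrow> rough (x powr \<alpha>) g"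
        "\<And>g. g \<in> G \<Longrightarrow> smooth (x powr \<gamma>) g"
        "\<And>g. g \<in> G \<Longrightarrow> x powr (j * \<alpha>) \<le> real g" "\<And>g. g \<in> G \<Longrightarrow> real g \<le> x powr (j * \<gamma>)"
      by blast
    let ?A = "{p. prime p \<and> x powr \<gamma> < real p \<and> real p \<le> x powr \<beta>}"
    have Ap: "rough (x powr \<gamma>) p" "smooth (x powr \<beta>) p" "squarefree p" if "p \<in> ?A" for p
      using that by (auto intro: rough_prime smooth_prime squarefree_prime)
    have powr_le: "x powr \<alpha> \<le> x powr \<gamma>" "x powr \<gamma> \<le> x powr \<beta>" "x powr (j * \<gamma>) \<le> x powr (j * \<beta>)"
      using \<gamma> elim by (auto intro!: powr_mono mult_left_mono)
    have pos: "g > 0" if "g \<in> G" for g using Gg(1)[OF that] by (cases "g = 0") auto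
    have inj: "inj_on (\<lambda>(g, p). g * p) (G \<times> ?A)"
    proof (rule inj_onI)
      fix u v assume uv: "u \<in> G \<times> ?A" "v \<in> G \<times> ?A" "(\<lambda>(g, p). g * p) u = (\<lambda>(g, p). g * p) v"
      obtain g p g' p' where eq: "u = (g, p)" "v = (g', p')" by (cases u, cases v)
      have "smooth (x powr \<gamma>) g" "rough (x powr \<gamma>) p" "smooth (x powr \<gamma>) g'" "rough (x powr \<gamma>) p'"
        "g > 0" "g * p = g' * p'"
        using uv unfolding eq by (auto intro: Gg(3) rough_prime pos)
      then show "u = v" unfolding eq using smooth_rough_factorization_unique by blast
    qed
    let ?G = "(\<lambda>(g, p). g * p) ` (G \<times> ?A)"
    have "finite ?A"
      by (rule finite_subset[of _ "{..nat \<lfloor>x powr \<beta>\<rfloor>}"]) (auto simp: le_nat_floor)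
    then have "finite ?G" using G by simp
    moreover have "\<forall>h\<in>?G. squarefree h \<and> rough (x powr \<alpha>) h \<and> smooth (x powr \<beta>) h \<and>
                  x powr (Suc j * \<alpha>) \<le> real h \<and> real h \<le> x powr (Suc j * \<beta>)"
    proof
      fix h assume "h \<in> ?G"
      then obtain g p where h: "h = g * p" and g: "g \<in> G" and p: "p \<in> ?A" by auto
      have "coprime g p" using Gg(3)[OF g] Ap(1)[OF p] by (rule coprime_smooth_rough)
      then have "squarefree h" unfolding h using Gg(1)[OF g] Ap(3)[OF p] by (simp add: squarefree_mult_coprime)
      moreover have "rough (x powr \<alpha>) h" unfolding h
        using Gg(2)[OF g] Ap(1)[OF p] powr_le by (blast intro: rough_mult rough_antimono)
      moreover have "smooth (x powr \<beta>) h" unfolding h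
        using Gg(3)[OF g] Ap(2)[OF p] powr_le by (blast intro: smooth_mult smooth_mono)
      moreover have "x powr (j * \<alpha>) * x powr \<alpha> \<le> real g * real p"
        using Gg(4)[OF g] p powr_le by (intro mult_mono) auto
      moreover have "real g * real p \<le> x powr (j * \<beta>) * x powr \<beta>"
        using Gg(5)[OF g] p powr_le by (intro mult_mono) auto
      ultimately show "squarefree h \<and> rough (x powr \<alpha>) h \<and> smooth (x powr \<beta>) h \<and>
                  x powr (Suc j * \<alpha>) \<le> real h \<and> real h \<le> x powr (Suc j * \<beta>)"
        unfolding h by (simp add: algebra_simps powr_add)
    qed
    moreover have "c * ((1 - \<gamma> / \<beta>) / 2) \<le> (\<Sum>g\<in>G. 1 / real g) * (\<Sum>p\<in>?A. 1 / real p)"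
      using G(2) elim(2) c c' by (intro mult_mono) (auto simp: zero_less_mult_iff)
    moreover have "(\<Sum>g\<in>G. 1 / real g) * (\<Sum>p\<in>?A. 1 / real p) = (\<Sum>h\<in>?G. 1 / real h)"
      by (subst sum.reindex[OF inj]) (simp add: sum_product sum.cartesian_product case_prod_unfold)
    ultimately show ?case by (intro exI[of _ ?G]) simp
  qed
  with c' show ?case by blast
qed

section \<open>Counting square-free integers\<close>

lemma card_multiples_le:
  fixes k n :: nat
  assumes "k > 0"
  shows "card {m \<in> {1..n}. k dvd m} \<le> n div k"
proof -
  have "{m \<in> {1..n}. k dvd m} \<subseteq> (\<lambda>i. k * i) ` {1..n div k}"
    using assms by (auto elim!: dvdE simp: less_eq_div_iff_mult_less_eq mult.commute Suc_le_eq)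
  then have "card {m \<in> {1..n}. k dvd m} \<le> card ((\<lambda>i. k * i) ` {1..n div k})"
    by (rule card_mono[rotated]) simp
  also have "\<dots> \<le> card {1..n div k}" by (rule card_image_le) simp
  finally show ?thesis by simp
qed

text \<open>
  Beyond \<open>d = 2\<close>, compare with the telescoping \<open>1 / (d - 1) - 1 / d\<close>.
\<close>

lemma sum_inverse_squares_le:
  fixes n :: nat
  assumes "n \<ge> 2"
  shows "(\<Sum>d=2..n. 1 / real d ^ 2) \<le> 3 / 4 - 1 / n"
  using assms
proof (induction n rule: nat_induct_at_least)
  case (Suc n)
  have "1 / (real n + 1) ^ 2 \<le> 1 / n - 1 / (real n + 1)"
    using Suc by (simp add: divide_simps power2_eq_square)
  then show ?case using Suc by (simp add: add.commute)
qed simp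

text \<open>
  An integer that is not square-free is a multiple of \<open>d ^ 2\<close> for some \<open>d \<ge> 2\<close>; by the union bound these
  make up at most three quarters of the integers up to \<open>N = \<lfloor>t\<rfloor>\<close>, and \<open>N \<ge> t / 2\<close>.
\<close>

lemma card_squarefree_ge:
  fixes t :: real
  assumes "t \<ge> 1"
  shows "t / 8 \<le> card {m::nat. m > 0 \<and> real m \<le> t \<and> squarefree m}"
proof -
  define N where "N = nat \<lfloor>t\<rfloor>"
  have "N \<ge> 1" "t - 1 < real N" using assms unfolding N_def by linarith+
  then have N: "real N \<ge> t / 2" by linarith
  have le_N: "real m \<le> t \<longleftrightarrow> m \<le> N" for m
    using assms unfolding N_def by (simp add: le_nat_iff le_floor_iff)
  let ?S = "{m::nat. m > 0 \<and> real m \<le> t \<and> squarefree m}"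
  let ?M = "\<lambda>d. {m \<in> {1..N}. d ^ 2 dvd m}"
  have "{1..N} \<subseteq> ?S \<union> (\<Union>d\<in>{2..N}. ?M d)"
  proof
    fix m assume m: "m \<in> {1..N}"
    show "m \<in> ?S \<union> (\<Union>d\<in>{2..N}. ?M d)"
    proof (cases "squarefree m")
      case False
      then obtain d where d: "d ^ 2 dvd m" "\<not> is_unit d" unfolding squarefree_def by auto
      have "d \<noteq> 0" using d m by (cases "d = 0") auto
      moreover have "d \<noteq> 1" using d by auto
      ultimately have "d \<ge> 2" by linarith
      moreover have "d \<le> d ^ 2" by (simp add: power2_eq_square)
      moreover have "d ^ 2 \<le> m" using d m by (auto intro: dvd_imp_le)
      ultimately show ?thesis using m d by auto
    qed (use m le_N in auto)
  qed
  moreover have finS: "finite ?S" by (rule finite_subset[of _ "{..N}"]) (auto simp: le_N)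
  ultimately have "N \<le> card (?S \<union> (\<Union>d\<in>{2..N}. ?M d))"
    using card_mono[of "?S \<union> (\<Union>d\<in>{2..N}. ?M d)" "{1..N}"] by simp
  also have "\<dots> \<le> card ?S + card (\<Union>d\<in>{2..N}. ?M d)" by (rule card_Un_le)
  also have "card (\<Union>d\<in>{2..N}. ?M d) \<le> (\<Sum>d=2..N. card (?M d))" by (rule card_UN_le) simp
  also have "\<dots> \<le> (\<Sum>d=2..N. N div d ^ 2)" by (intro sum_mono card_multiples_le) auto
  finally have "real N \<le> real (card ?S + (\<Sum>d=2..N. N div d ^ 2))" by (simp only: of_nat_le_iff add_left_mono)
  also have "\<dots> \<le> real (card ?S) + (\<Sum>d=2..N. real N * (1 / real d ^ 2))"
    unfolding of_nat_add of_nat_sum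
    by (intro add_left_mono sum_mono) (use of_nat_div_le_of_nat in \<open>fastforce simp flip: of_nat_power\<close>)
  also have "(\<Sum>d=2..N. real N * (1 / real d ^ 2)) = real N * (\<Sum>d=2..N. 1 / real d ^ 2)"
    by (rule sum_distrib_left[symmetric])
  also have "\<dots> \<le> real N * (3 / 4)"
  proof (rule mult_left_mono)
    show "(\<Sum>d=2..N. 1 / real d ^ 2) \<le> 3 / 4"
    proof (cases "N \<ge> 2")
      case True
      have "0 \<le> 1 / real N" by simp
      then show ?thesis using sum_inverse_squares_le[OF True] by linarith
    qed simp
  qed simp
  finally show ?thesis using N by simp
qed

lemma finite_Q_set: "finite {n::nat. n > 0 \<and> real n \<le> x \<and> squarefree n \<and> (\<forall>p. prime p \<longrightarrow> p dvd n \<longrightarrow> p \<in> P)}"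
  by (rule finite_subset[of _ "{..nat \<lfloor>x\<rfloor>}"]) (auto simp: le_nat_floor)

lemma Q_mono:
  assumes "P \<subseteq> P'"
  shows "Q P x \<le> Q P' x"
  unfolding Q_def using assms by (intro card_mono finite_Q_set) auto

text \<open>
  The counting of the products \<open>m * g\<close> described at the beginning. The exponents \<open>\<alpha> = 1 / (K + 1)\<close> and
  \<open>\<beta> = 1 / K\<close> are chosen so that \<open>K * \<beta> = 1\<close>, which keeps \<open>g\<close> below \<open>x\<close>, and \<open>1 - K * \<alpha> = \<alpha>\<close>, which makes
  every cofactor \<open>m \<le> x / g\<close> automatically \<open>x powr \<alpha>\<close>-smooth.
\<close>

lemma eventually_Q_root_ge:
  fixes K :: nat
  assumes "K > 0"
  shows "\<exists>c>0. \<forall>\<^sub>F x::real in at_top. c * x \<le> Q (primes_upto (x powr (1 / K))) x"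
proof -
  define \<alpha> \<beta> :: real where "\<alpha> = 1 / (K + 1)" and "\<beta> = 1 / K"
  have ab: "0 < \<alpha>" "\<alpha> < \<beta>" "K * \<beta> = 1" "1 - K * \<alpha> = \<alpha>"
    unfolding \<alpha>_def \<beta>_def using assms by (auto simp: field_simps)
  obtain c where c: "c > 0"
    and ev: "\<forall>\<^sub>F x in at_top. \<exists>G. finite G \<and>
           (\<forall>g\<in>G. squarefree g \<and> rough (x powr \<alpha>) g \<and> smooth (x powr \<beta>) g \<and>
                  x powr (K * \<alpha>) \<le> real g \<and> real g \<le> x powr (K * \<beta>)) \<and>
           c \<le> (\<Sum>g\<in>G. 1 / real g)"
    using eventually_prime_products[OF ab(1,2)] by blast
  have "\<forall>\<^sub>F x::real in at_top. c / 8 * x \<le> Q (primes_upto (x powr (1 / K))) x"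
    using ev eventually_gt_at_top[of "1::real"]
  proof eventually_elim
    case (elim x)
    then obtain G where G: "finite G" "c \<le> (\<Sum>g\<in>G. 1 / real g)"
      and Gg: "\<And>g. g \<in> G \<Longrightarrow> squarefree g" "\<And>g. g \<in> G \<Longrightarrow> rough (x powr \<alpha>) g"
        "\<And>g. g \<in> G \<Longrightarrow> smooth (x powr \<beta>) g"
        "\<And>g. g \<in> G \<Longrightarrow> x powr (K * \<alpha>) \<le> real g" "\<And>g. g \<in> G \<Longrightarrow> real g \<le> x"
      using ab(3) by auto
    have pos: "g > 0" if "g \<in> G" for g using Gg(1)[OF that] by (cases "g = 0") auto
    define T where "T = (\<lambda>g. {m::nat. m > 0 \<and> real m \<le> x / real g \<and> squarefree m})"
    have T_smooth: "smooth (x powr \<alpha>) m" if "g \<in> G" "m \<in> T g" for g m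
    proof (rule smooth_le)
      have "real m \<le> x / real g" using that unfolding T_def by simp
      also have "\<dots> \<le> x / x powr (K * \<alpha>)"
        using Gg(4)[OF that(1)] pos[OF that(1)] elim by (intro divide_left_mono) auto
      also have "\<dots> = x powr (1 - K * \<alpha>)" using elim by (simp add: powr_diff)
      finally show "real m \<le> x powr \<alpha>" unfolding ab(4) .
    qed (use that in \<open>simp add: T_def\<close>)
    have finT: "finite (T g)" for g
      unfolding T_def by (rule finite_subset[of _ "{..nat \<lfloor>x / g\<rfloor>}"]) (auto simp: le_nat_floor)
    have inj: "inj_on (\<lambda>(g, m). m * g) (Sigma G T)"
    proof (rule inj_onI, clarify)
      fix g m g' m'
      assume *: "g \<in> G" "m \<in> T g" "g' \<in> G" "m' \<in> T g'" "m * g = m' * g'"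
      have "m > 0" using * by (simp add: T_def)
      then show "g = g' \<and> m = m'"
        using smooth_rough_factorization_unique[of "x powr \<alpha>" m g m' g'] * T_smooth Gg(2) by blast
    qed
    have sub: "(\<lambda>(g, m). m * g) ` Sigma G T \<subseteq> {n::nat. n > 0 \<and> real n \<le> x \<and> squarefree n \<and>
        (\<forall>p. prime p \<longrightarrow> p dvd n \<longrightarrow> p \<in> primes_upto (x powr (1 / K)))}"
    proof clarify
      fix g m assume *: "g \<in> G" "m \<in> T g"
      have "x powr \<alpha> \<le> x powr \<beta>" using ab elim by (intro powr_mono) auto
      then have "smooth (x powr \<beta>) (m * g)"
        using T_smooth[OF *] Gg(3)[OF *(1)] by (blast intro: smooth_mult smooth_mono)
      moreover have "coprime m g" using T_smooth[OF *] Gg(2)[OF *(1)] by (rule coprime_smooth_rough)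
      then have "squarefree (m * g)"
        using * Gg(1) by (simp add: squarefree_mult_coprime T_def)
      moreover have "real (m * g) \<le> x" "0 < m * g"
        using * pos[OF *(1)] by (auto simp: T_def field_simps)
      ultimately show "0 < m * g \<and> real (m * g) \<le> x \<and> squarefree (m * g) \<and>
          (\<forall>p. prime p \<longrightarrow> p dvd m * g \<longrightarrow> p \<in> primes_upto (x powr (1 / K)))"
        unfolding smooth_def primes_upto_def \<beta>_def by auto
    qed
    have "c / 8 * x \<le> (\<Sum>g\<in>G. 1 / real g) * (x / 8)"
      using G(2) elim by (simp add: field_simps mult_right_mono)
    also have "\<dots> = (\<Sum>g\<in>G. x / real g / 8)" by (simp add: sum_distrib_right)
    also have "\<dots> \<le> (\<Sum>g\<in>G. real (card (T g)))"
      unfolding T_def by (intro sum_mono card_squarefree_ge) (use Gg(5) pos in auto)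
    also have "\<dots> = real (card (Sigma G T))" using G finT by simp
    also have "\<dots> = real (card ((\<lambda>(g, m). m * g) ` Sigma G T))" by (simp add: card_image[OF inj])
    also have "\<dots> \<le> Q (primes_upto (x powr (1 / K))) x"
      unfolding Q_def using card_mono[OF finite_Q_set sub] by simp
    finally show ?case .
  qed
  moreover have "c / 8 > 0" using c by simp
  ultimately show ?thesis by blast
qed

theorem proposition1p1:
  fixes lam :: "real \<Rightarrow> real" and \<epsilon> :: real
  assumes "\<And>x. lam x \<ge> 1"
    and "mono lam"
    and "0 < \<epsilon>" and "\<epsilon> < 1"
    and "lam \<in> \<Omega>(\<lambda>x. x powr \<epsilon>)"
    and "(\<lambda>x. ln (lam x)) \<in> O(\<lambda>x. ln x)"
  shows "(\<lambda>x. real (Q (primes_upto (lam x)) x)) \<in> \<Theta>(\<lambda>x. x * (ln (lam x) / ln x))"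
proof -
  obtain K :: nat where K: "1 / \<epsilon> < K" using reals_Archimedean2 by blast
  have "K > 0" using K assms(3) by (cases K) (auto simp: not_less)
  then have K': "1 / K < \<epsilon>" using K assms(3) by (simp add: field_simps)
  obtain a where a: "a > 0" "\<forall>\<^sub>F x in at_top. a * norm (x powr \<epsilon>) \<le> norm (lam x)"
    using assms(5) by (elim landau_omega.bigE)
  \<comment> \<open>The slack between \<open>1 / K\<close> and \<open>\<epsilon>\<close> absorbs the constant \<open>a\<close>.\<close>
  have lam_ge: "\<forall>\<^sub>F x in at_top. x powr (1 / K) \<le> lam x"
    using a(2) eventually_gt_at_top[of "1::real"] eventually_ge_at_top[of "(1 / a) powr (1 / (\<epsilon> - 1 / K))"]
  proof eventually_elim
    case (elim x)
    have "1 / a = ((1 / a) powr (1 / (\<epsilon> - 1 / K))) powr (\<epsilon> - 1 / K)"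
      using a K' by (simp add: powr_powr)
    also have "\<dots> \<le> x powr (\<epsilon> - 1 / K)" using elim K' by (intro powr_mono2) auto
    finally have "x powr (1 / K) * 1 \<le> x powr (1 / K) * (a * x powr (\<epsilon> - 1 / K))"
      using a by (intro mult_left_mono) (auto simp: field_simps)
    also have "\<dots> = a * x powr \<epsilon>" using elim by (simp flip: powr_add)
    finally show ?case using elim assms(1)[of x] by simp
  qed
  have "\<forall>\<^sub>F x in at_top. norm (real (Q (primes_upto (lam x)) x)) \<le> K * norm (x * (ln (lam x) / ln x))"
    using lam_ge eventually_gt_at_top[of "1::real"]
  proof eventually_elim
    case (elim x)
    have "ln (x powr (1 / K)) \<le> ln (lam x)" using elim by (intro ln_mono) auto
    then have "1 \<le> K * (ln (lam x) / ln x)"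
      using elim \<open>K > 0\<close> by (simp add: ln_powr field_simps)
    then have "x * 1 \<le> x * (K * (ln (lam x) / ln x))" using elim by (intro mult_left_mono) auto
    then show ?case using Q_le[of x "primes_upto (lam x)"] elim assms(1)[of x] by (simp add: abs_mult mult.left_commute)
  qed
  then have upper: "(\<lambda>x. real (Q (primes_upto (lam x)) x)) \<in> O(\<lambda>x. x * (ln (lam x) / ln x))"
    by (rule bigoI)
  obtain C where C: "C > 0" "\<forall>\<^sub>F x in at_top. norm (ln (lam x)) \<le> C * norm (ln x)"
    using assms(6) by (elim landau_o.bigE)
  obtain c where c: "c > 0" "\<forall>\<^sub>F x::real in at_top. c * x \<le> Q (primes_upto (x powr (1 / K))) x"
    using eventually_Q_root_ge[OF \<open>K > 0\<close>] by blast
  have "\<forall>\<^sub>F x in at_top. c / C * norm (x * (ln (lam x) / ln x)) \<le> norm (real (Q (primes_upto (lam x)) x))"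
    using lam_ge C(2) c(2) eventually_gt_at_top[of "1::real"]
  proof eventually_elim
    case (elim x)
    have "ln (lam x) / ln x \<le> C" using elim assms(1)[of x] by (simp add: field_simps)
    then have "c / C * (x * (ln (lam x) / ln x)) \<le> c / C * (x * C)"
      using elim c C by (intro mult_left_mono) auto
    also have "\<dots> = c * x" using C by simp
    also have "\<dots> \<le> Q (primes_upto (x powr (1 / K))) x" using elim by simp
    also have "\<dots> \<le> Q (primes_upto (lam x)) x"
      using elim by (intro of_nat_mono Q_mono) (auto simp: primes_upto_def)
    finally show ?case using elim assms(1)[of x] by (simp add: abs_mult)
  qed
  moreover have "c / C > 0" using c C by simp
  ultimately have "(\<lambda>x. real (Q (primes_upto (lam x)) x)) \<in> \<Omega>(\<lambda>x. x * (ln (lam x) / ln x))"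
    by (intro landau_omega.bigI[of "c / C"])
  with upper show ?thesis by (rule bigthetaI)
qed

end
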